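(* Let $X$ be a real Banach space with $X \neq \{0\}$. Then $X$ admits a tiling of order $2$ by closed convex bounded bodies; that is, there is a family $\tau$ of closed, convex, bounded bodies in $X$ whose union is $X$, whose interiors are pairwise disjoint, and such that no point of $X$ belongs to more than two members of $\tau$.
   Context: A body in $X$ is a nonempty proper subset of $X$ that is contained in the closure of its interior, this interior being connected. A covering of $X$ is a family of proper subsets of $X$ whose union is $X$. A tiling of $X$ is a covering whose members (tiles) are closed bodies with pairwise disjoint interiors. The order of a covering $\tau$ is the supremum of those $n \in \mathbb{N}$ for which there exist $n$ members of $\tau$ having a common point; order $2$ means no point of $X$ lies in more than two members. *)

theory Defs
  imports "HOL-Analysis.Analysis" "HOL-Library.Extended_Nat"
begin

definition is_body :: "'a::topological_space set \<Rightarrow> bool" where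
  "is_body B \<longleftrightarrow> B \<noteq> {} \<and> B \<noteq> UNIV \<and> B \<subseteq> closure (interior B) \<and> connected (interior B)"

definition is_covering :: "'a set set \<Rightarrow> bool" where
  "is_covering \<tau> \<longleftrightarrow> (\<forall>T\<in>\<tau>. T \<noteq> UNIV) \<and> \<Union>\<tau> = UNIV"

definition is_tiling :: "'a::topological_space set set \<Rightarrow> bool" where
  "is_tiling \<tau> \<longleftrightarrow> is_covering \<tau> \<and> (\<forall>T\<in>\<tau>. closed T \<and> is_body T) \<and>
     (\<forall>A\<in>\<tau>. \<forall>B\<in>\<tau>. A \<noteq> B \<longrightarrow> interior A \<inter> interior B = {})"

definition covering_order :: "'a set set \<Rightarrow> enat" where
  "covering_order \<tau> = Sup {enat n | n. \<exists>S \<subseteq> \<tau>. finite S \<and> card S = n \<and> \<Inter>S \<noteq> {}}"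

end

theory Submission
  imports Defs
begin

text \<open>
  The shell between the balls of radius \<open>n\<close> and \<open>n + 1\<close> is cut away from outside by a transfinite
  sequence of hyperplanes supporting the inner ball: by the Hahn--Banach theorem every point of the
  shell has a first functional \<open>f\<close> of the dual unit ball with value greater than \<open>n\<close>. The part of the
  remaining body \<open>C\<close> with \<open>f > n\<close> is tiled by parallel slices whose thickness shrinks towards the
  hyperplane \<open>f = n\<close>. Since no slice touches that hyperplane, a point can only lie in two slices
  that are consecutive for the same \<open>n\<close> and \<open>f\<close>.
\<close>

section \<open>The Hahn--Banach theorem for the norm\<close>

text \<open>The scaling condition is only an inequality; applying it with \<open>1 / c\<close> gives
  the reverse one, and \<open>c = 0\<close> forces \<open>p 0 = 0\<close>.\<close>

definition sublinear :: "('a::real_vector \<Rightarrow> real) \<Rightarrow> bool" where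
  "sublinear p \<longleftrightarrow> (\<forall>x y. p (x + y) \<le> p x + p y) \<and> (\<forall>c\<ge>0. \<forall>x. p (c *\<^sub>R x) \<le> c * p x)"

lemma sublinear_add: "sublinear p \<Longrightarrow> p (x + y) \<le> p x + p y"
  by (simp add: sublinear_def)

lemma sublinear_zero: "sublinear p \<Longrightarrow> p 0 = 0"
proof -
  assume p: "sublinear p"
  have "p (0 *\<^sub>R 0) \<le> 0 * p 0"
    using p unfolding sublinear_def by blast
  with sublinear_add[OF p, of 0 0] show ?thesis by simp
qed

lemma sublinear_scaleR:
  assumes p: "sublinear p" and "0 \<le> c"
  shows "p (c *\<^sub>R x) = c * p x"
proof (cases "c = 0")
  case True
  then show ?thesis using sublinear_zero[OF p] by simp
next
  case False
  with \<open>0 \<le> c\<close> have c: "0 < c" by simp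
  have "p ((1 / c) *\<^sub>R (c *\<^sub>R x)) \<le> (1 / c) * p (c *\<^sub>R x)"
    using p c unfolding sublinear_def by (metis less_eq_real_def zero_less_divide_1_iff)
  then have "c * p x \<le> p (c *\<^sub>R x)"
    using c by (simp add: field_simps)
  moreover have "p (c *\<^sub>R x) \<le> c * p x"
    using p \<open>0 \<le> c\<close> unfolding sublinear_def by blast
  ultimately show ?thesis by simp
qed

lemma sublinear_ge_neg: "sublinear p \<Longrightarrow> - p (- x) \<le> p x"
  using sublinear_add[of p x "- x"] sublinear_zero[of p] by simp

lemma sublinear_norm: "sublinear norm"
  by (simp add: sublinear_def norm_triangle_ineq)

text \<open>The infimum over \<open>t \<ge> 0\<close> of \<open>p (x + t y) - t p y\<close> is the
  classical way to push \<open>p\<close> down in the direction \<open>- y\<close>. A sublinear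
  function that cannot be lowered further is therefore odd, hence linear.\<close>

lemma sublinear_lower_direction:
  fixes p :: "'a::real_vector \<Rightarrow> real"
  assumes p: "sublinear p"
  obtains q where "sublinear q" "\<And>x. q x \<le> p x" "q (- y) \<le> - p y"
proof -
  define h where "h x t = p (x + t *\<^sub>R y) - t * p y" for x t
  define q where "q x = (INF t\<in>{0..}. h x t)" for x
  \<comment> \<open>The vectors \<open>x + t y\<close> and \<open>- x\<close> add up to
    \<open>t y\<close>, so subadditivity bounds the family below independently of \<open>t\<close>,
    and the infimum is finite.\<close>
  have lower: "- p (- x) \<le> h x t" if "0 \<le> t" for x t
    using sublinear_add[OF p, of "x + t *\<^sub>R y" "- x"] sublinear_scaleR[OF p that, of y]
    by (simp add: h_def)
  have bdd: "bdd_below (h x ` {0..})" for x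
    using lower by (intro bdd_belowI2[of _ "- p (- x)"]) auto
  have le: "q x \<le> h x t" if "0 \<le> t" for x t
    unfolding q_def using that by (intro cINF_lower bdd) auto
  have ge: "u \<le> q x" if "\<And>t. 0 \<le> t \<Longrightarrow> u \<le> h x t" for u x
    unfolding q_def using that by (intro cINF_greatest) auto
  have q_le: "q x \<le> p x" for x
    using le[of 0 x] by (simp add: h_def)
  have "q (x1 + x2) \<le> q x1 + q x2" for x1 x2
  proof -
    have "q (x1 + x2) - h x2 t2 \<le> q x1" if t2: "0 \<le> t2" for t2
    proof (rule ge)
      fix t1 :: real assume t1: "0 \<le> t1"
      have "q (x1 + x2) \<le> h (x1 + x2) (t1 + t2)"
        using t1 t2 by (intro le) simp
      also have "\<dots> \<le> h x1 t1 + h x2 t2"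
        using sublinear_add[OF p, of "x1 + t1 *\<^sub>R y" "x2 + t2 *\<^sub>R y"]
        by (simp add: h_def algebra_simps)
      finally show "q (x1 + x2) - h x2 t2 \<le> h x1 t1" by simp
    qed
    then have "q (x1 + x2) - q x1 \<le> q x2"
      by (intro ge) (simp add: algebra_simps)
    then show ?thesis by simp
  qed
  moreover have "q (c *\<^sub>R x) \<le> c * q x" if c: "0 \<le> c" for c x
  proof (cases "c = 0")
    case True
    then show ?thesis using q_le[of 0] sublinear_zero[OF p] by simp
  next
    case False
    with c have c': "0 < c" by simp
    have "q (c *\<^sub>R x) / c \<le> q x"
    proof (rule ge)
      fix t :: real assume t: "0 \<le> t"
      have "q (c *\<^sub>R x) \<le> h (c *\<^sub>R x) (c * t)"
        using t c by (intro le) simp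
      also have "\<dots> = c * h x t"
        using sublinear_scaleR[OF p c, of "x + t *\<^sub>R y"] by (simp add: h_def algebra_simps)
      finally show "q (c *\<^sub>R x) / c \<le> h x t"
        using c' by (simp add: field_simps)
    qed
    then show ?thesis using c' by (simp add: field_simps)
  qed
  ultimately have "sublinear q" by (simp add: sublinear_def)
  moreover have "q (- y) \<le> - p y"
    using le[of 1 "- y"] sublinear_zero[OF p] by (simp add: h_def)
  ultimately show thesis using that q_le by blast
qed

text \<open>Subadditivity is where the chain matters: the smaller of \<open>p\<close> and
  \<open>q\<close> bounds \<open>i (x + y)\<close> by \<open>p x + q y\<close>, after which the
  infima over \<open>p\<close> and \<open>q\<close> can be taken separately.\<close>

lemma sublinear_chain_INF:
  fixes C :: "('a::real_vector \<Rightarrow> real) set"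
  assumes ne: "C \<noteq> {}" and sub: "\<And>p. p \<in> C \<Longrightarrow> sublinear p"
    and chain: "\<And>p q. p \<in> C \<Longrightarrow> q \<in> C \<Longrightarrow> p \<le> q \<or> q \<le> p"
    and bdd: "\<And>x. bdd_below ((\<lambda>p. p x) ` C)"
  shows "sublinear (\<lambda>x. INF p\<in>C. p x)"
proof -
  define i where "i x = (INF p\<in>C. p x)" for x
  have le: "i x \<le> p x" if "p \<in> C" for p x
    unfolding i_def using that by (intro cINF_lower bdd)
  have ge: "u \<le> i x" if "\<And>p. p \<in> C \<Longrightarrow> u \<le> p x" for u x
    unfolding i_def using that ne by (intro cINF_greatest) auto
  have "i (x + y) \<le> i x + i y" for x y
  proof -
    have step: "i (x + y) \<le> p x + q y" if pq: "p \<in> C" "q \<in> C" for p q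
    proof -
      obtain m where m: "m \<in> C" "m \<le> p" "m \<le> q"
        using chain[OF pq] pq by blast
      have "i (x + y) \<le> m x + m y"
        using le[OF m(1), of "x + y"] sublinear_add[OF sub[OF m(1)], of x y] by simp
      also have "\<dots> \<le> p x + q y"
        using m(2,3) by (simp add: add_mono le_funD)
      finally show ?thesis .
    qed
    have "i (x + y) - q y \<le> i x" if "q \<in> C" for q
      using step that by (intro ge) (simp add: algebra_simps)
    then have "i (x + y) - i x \<le> i y"
      by (intro ge) (simp add: algebra_simps)
    then show ?thesis by simp
  qed
  moreover have "i (c *\<^sub>R x) \<le> c * i x" if c: "0 \<le> c" for c x
  proof -
    have step: "i (c *\<^sub>R x) \<le> c * p x" if "p \<in> C" for p
      using le[OF that, of "c *\<^sub>R x"] sublinear_scaleR[OF sub[OF that] c, of x] by simp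
    show ?thesis
    proof (cases "c = 0")
      case True
      then show ?thesis using step ne by auto
    next
      case False
      with c have c': "0 < c" by simp
      have "i (c *\<^sub>R x) / c \<le> i x"
        using step c' by (intro ge) (simp add: field_simps)
      then show ?thesis using c' by (simp add: field_simps)
    qed
  qed
  ultimately show ?thesis by (simp add: sublinear_def i_def)
qed

text \<open>Zorn's lemma for the reversed pointwise order: the pointwise infimum of a chain bounds
  it from the required side.\<close>

lemma exists_minimal_sublinear:
  fixes p0 :: "'a::real_vector \<Rightarrow> real"
  assumes p0: "sublinear p0"
  obtains p where "sublinear p" "p \<le> p0" "\<And>q. sublinear q \<Longrightarrow> q \<le> p \<Longrightarrow> q = p"
proof -
  define A where "A = {p. sublinear p \<and> p \<le> p0}"
  have po: "partial_order_on A (relation_of (\<lambda>p q. q \<le> p) A)"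
    by (rule partial_order_on_relation_ofI) auto
  have "\<exists>m\<in>A. \<forall>a\<in>A. a \<le> m \<longrightarrow> a = m"
  proof (rule predicate_Zorn[OF po])
    fix C assume C: "C \<in> Chains (relation_of (\<lambda>p q. q \<le> p) A)"
    then have CA: "C \<subseteq> A" and chain: "\<And>p q. p \<in> C \<Longrightarrow> q \<in> C \<Longrightarrow> p \<le> q \<or> q \<le> p"
      unfolding Chains_def relation_of_def by auto
    show "\<exists>u\<in>A. \<forall>a\<in>C. u \<le> a"
    proof (cases "C = {}")
      case True
      then show ?thesis using p0 by (auto simp: A_def)
    next
      case False
      have sub: "sublinear p" if "p \<in> C" for p
        using that CA by (auto simp: A_def)
      \<comment> \<open>Every sublinear function below \<open>p0\<close> shares this lower bound, so
        pointwise infima exist in the reals.\<close>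
      have "- p0 (- x) \<le> p x" if "p \<in> C" for p x
      proof -
        have "p (- x) \<le> p0 (- x)" using that CA by (auto simp: A_def le_fun_def)
        with sublinear_ge_neg[OF sub[OF that], of x] show ?thesis by simp
      qed
      then have bdd: "bdd_below ((\<lambda>p. p x) ` C)" for x
        by (intro bdd_belowI2[of _ "- p0 (- x)"]) auto
      define i where "i x = (INF p\<in>C. p x)" for x
      have le: "i \<le> p" if "p \<in> C" for p
        unfolding i_def using that by (intro le_funI cINF_lower bdd)
      have "sublinear i"
        unfolding i_def by (rule sublinear_chain_INF[OF False sub chain bdd])
      moreover obtain p where "p \<in> C" using False by blast
      then have "i \<le> p0" using le[of p] CA by (auto simp: A_def)
      ultimately show ?thesis using le by (auto simp: A_def)
    qed
  qed
  then obtain m where m: "m \<in> A" "\<And>a. a \<in> A \<Longrightarrow> a \<le> m \<Longrightarrow> a = m" by blast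
  show thesis
  proof (rule that)
    show "sublinear m" "m \<le> p0" using m(1) by (auto simp: A_def)
    show "q = m" if "sublinear q" "q \<le> m" for q
      using m that by (auto simp: A_def)
  qed
qed

section \<open>The dual unit ball and norming functionals\<close>

definition dual_ball :: "('a::real_normed_vector \<Rightarrow> real) set" where
  "dual_ball = {f. linear f \<and> (\<forall>x. f x \<le> norm x)}"

text \<open>By linearity, the one-sided bound at \<open>- x\<close> yields the bound on the absolute
  value.\<close>

lemma dual_ball_bounded_linear:
  assumes "f \<in> dual_ball"
  shows "bounded_linear f"
proof -
  have lin: "linear f" and le: "\<And>x. f x \<le> norm x"
    using assms by (auto simp: dual_ball_def)
  have "\<bar>f x\<bar> \<le> norm x" for x
    using le[of x] le[of "- x"] linear_neg[OF lin, of x] by simp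
  then show ?thesis
    using lin by (intro linear_conv_bounded_linear[THEN iffD1] bounded_linear_intro[of f 1])
      (auto simp: linear_add linear_scale)
qed

text \<open>Lower the norm in the direction \<open>- x0\<close> first, then take a minimal sublinear
  \<open>f\<close> below the result. Minimality makes \<open>f\<close> linear, and the lowered value
  at \<open>- x0\<close> becomes \<open>norm x0 \<le> f x0\<close>.\<close>

theorem Hahn_Banach_norm:
  fixes x0 :: "'a::real_normed_vector"
  obtains f where "f \<in> dual_ball" "f x0 = norm x0"
proof -
  obtain p0 :: "'a \<Rightarrow> real"
    where p0: "sublinear p0" "\<And>x. p0 x \<le> norm x" "p0 (- x0) \<le> - norm x0"
    using sublinear_lower_direction[OF sublinear_norm] by metis
  obtain f where f: "sublinear f" "f \<le> p0"
    and minimal: "\<And>q. sublinear q \<Longrightarrow> q \<le> f \<Longrightarrow> q = f"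
    using exists_minimal_sublinear[OF p0(1)] by metis
  \<comment> \<open>Lowering \<open>f\<close> in the direction \<open>- y\<close> cannot change it,
    by minimality.\<close>
  have neg: "f (- y) = - f y" for y
  proof -
    obtain q where q: "sublinear q" "\<And>x. q x \<le> f x" "q (- y) \<le> - f y"
      using sublinear_lower_direction[OF f(1)] by metis
    have "q = f" using q by (intro minimal le_funI) auto
    then show ?thesis using q(3) sublinear_ge_neg[OF f(1), of "- y"] by simp
  qed
  have add: "f (x + y) = f x + f y" for x y
    using sublinear_add[OF f(1), of x y] sublinear_add[OF f(1), of "- x" "- y"]
      neg[of x] neg[of y] neg[of "x + y"] by simp
  have scale: "f (c *\<^sub>R x) = c * f x" for c x
    using sublinear_scaleR[OF f(1), of c x] sublinear_scaleR[OF f(1), of "- c" x]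
      neg[of "c *\<^sub>R x"] by (cases "0 \<le> c") auto
  have le: "f x \<le> norm x" for x
    using f(2) p0(2)[of x] by (meson le_funD order_trans)
  have "linear f" using add scale by (simp add: linear_iff)
  moreover have "norm x0 \<le> f x0"
    using p0(3) f(2) neg[of x0] le_funD[of f p0 "- x0"] by simp
  ultimately show thesis
    using le le[of x0] by (intro that) (auto simp: dual_ball_def)
qed

section \<open>Slicing a convex set\<close>

text \<open>The target is the image of \<open>ball z e\<close> under the homothety with centre
  \<open>x\<close> and ratio \<open>t\<close>, which maps \<open>S\<close> into itself by
  convexity.\<close>

lemma ball_shrink_subset_convex:
  fixes S :: "'a::real_normed_vector set"
  assumes S: "convex S" and b: "ball z e \<subseteq> S" and x: "x \<in> S" and t: "0 < t" "t \<le> 1"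
  shows "ball (x + t *\<^sub>R (z - x)) (t * e) \<subseteq> S"
proof
  fix y assume y: "y \<in> ball (x + t *\<^sub>R (z - x)) (t * e)"
  \<comment> \<open>The preimage of \<open>y\<close> under the homothety.\<close>
  define w where "w = z + (1 / t) *\<^sub>R (y - (x + t *\<^sub>R (z - x)))"
  have "dist z w = norm (y - (x + t *\<^sub>R (z - x))) / t"
    using t by (simp add: w_def dist_norm)
  also have "\<dots> < e"
    using y t by (simp add: dist_norm norm_minus_commute pos_divide_less_eq mult.commute)
  finally have "w \<in> S" using b by (auto simp: mem_ball)
  moreover have "y = (1 - t) *\<^sub>R x + t *\<^sub>R w"
    using t by (simp add: w_def algebra_simps)
  ultimately show "y \<in> S"
    using convexD[OF S x, of w "1 - t" t] t by simp
qed

text \<open>Points of the segment from \<open>x\<close> towards an interior point \<open>z\<close>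
  are interior, and they converge to \<open>x\<close>.\<close>

lemma convex_subset_closure_interior:
  fixes S :: "'a::real_normed_vector set"
  assumes S: "convex S" and "interior S \<noteq> {}"
  shows "S \<subseteq> closure (interior S)"
proof
  fix x assume x: "x \<in> S"
  obtain z e where e: "0 < e" and b: "ball z e \<subseteq> S"
    using assms(2) by (auto simp: mem_interior)
  have "x + t *\<^sub>R (z - x) \<in> interior S" if "0 < t" "t \<le> 1" for t
    using ball_shrink_subset_convex[OF S b x that] that e
    by (auto simp: mem_interior intro!: exI[of _ "t * e"])
  then have mem: "\<forall>n. x + (1 / real (Suc n)) *\<^sub>R (z - x) \<in> interior S"
    by simp
  have "(\<lambda>n. x + (1 / real (Suc n)) *\<^sub>R (z - x)) \<longlonglongrightarrow> x + 0 *\<^sub>R (z - x)"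
    by (intro tendsto_intros LIMSEQ_Suc[OF lim_1_over_n])
  then have lim: "(\<lambda>n. x + (1 / real (Suc n)) *\<^sub>R (z - x)) \<longlonglongrightarrow> x" by simp
  show "x \<in> closure (interior S)"
    unfolding closure_sequential by (rule exI, rule conjI, rule mem, rule lim)
qed

lemma is_body_convex:
  fixes S :: "'a::real_normed_vector set"
  assumes "convex S" "interior S \<noteq> {}" "S \<noteq> UNIV"
  shows "is_body S"
  using assms convex_subset_closure_interior[of S] convex_connected[OF convex_interior[of S]]
    interior_subset[of S]
  unfolding is_body_def by blast

text \<open>A nonzero vector has multiples of arbitrarily large norm; this is how nontriviality of
  the space makes bounded tiles proper subsets.\<close>

lemma bounded_ne_UNIV:
  fixes S :: "'a::real_normed_vector set"
  assumes "bounded S" and "w \<noteq> (0 :: 'a)"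
  shows "S \<noteq> UNIV"
proof -
  obtain b where b: "\<And>x. x \<in> S \<Longrightarrow> norm x \<le> b"
    using assms(1) by (auto simp: bounded_iff)
  have "((\<bar>b\<bar> + 1) / norm w) *\<^sub>R w \<notin> S"
    using b[of "((\<bar>b\<bar> + 1) / norm w) *\<^sub>R w"] assms(2) by auto
  then show ?thesis by blast
qed

text \<open>With \<open>s\<close> the supremum of \<open>f\<close> on \<open>C\<close>, the cuts are
  at the heights \<open>a + (s - a) / m\<close> for \<open>m = 1, 2, ...\<close>. Slice
  \<open>0\<close> reaches up to \<open>s\<close>, and the slices accumulate at the level
  \<open>a\<close> without meeting it.\<close>

definition slice :: "'a set \<Rightarrow> ('a \<Rightarrow> real) \<Rightarrow> real \<Rightarrow> nat \<Rightarrow> 'a set" where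
  "slice C f a k = {x \<in> C. a + (Sup (f ` C) - a) / (real k + 2) \<le> f x \<and>
     f x \<le> a + (Sup (f ` C) - a) / (real k + 1)}"

text \<open>The positive threshold \<open>a\<close> makes the centre of \<open>C\<close> lie strictly below all slices.\<close>

locale sliced_body =
  fixes C :: "'a::real_normed_vector set" and f :: "'a \<Rightarrow> real" and a e R :: real
  assumes convex: "convex C" and closed: "closed C" and bounded: "C \<subseteq> cball 0 R"
    and ball: "ball 0 e \<subseteq> C" and e_pos: "0 < e" and a_pos: "0 < a"
    and f: "f \<in> dual_ball" and exceeds: "\<exists>x\<in>C. a < f x"
begin

abbreviation "s \<equiv> Sup (f ` C)"

lemma bdd: "bdd_above (f ` C)"
proof (rule bdd_aboveI2)
  fix x assume "x \<in> C"
  then show "f x \<le> R"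
    using bounded f by (force simp: dual_ball_def intro: order_trans[of _ "norm x"])
qed

lemma le_s: "x \<in> C \<Longrightarrow> f x \<le> s"
  by (intro cSUP_upper bdd)

lemma a_less_s: "a < s"
  using exceeds le_s by force

lemma blin: "bounded_linear f"
  by (rule dual_ball_bounded_linear[OF f])

lemma slice_subset: "slice C f a k \<subseteq> C"
  by (auto simp: slice_def)

lemma slice_exceeds: "x \<in> slice C f a k \<Longrightarrow> a < f x"
proof -
  assume "x \<in> slice C f a k"
  then have "a + (s - a) / (real k + 2) \<le> f x" by (simp add: slice_def)
  moreover have "0 < (s - a) / (real k + 2)" using a_less_s by simp
  ultimately show ?thesis by linarith
qed

lemma slices_cover:
  assumes x: "x \<in> C" "a < f x"
  shows "\<exists>k. x \<in> slice C f a k"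
proof -
  define u where "u = f x - a"
  \<comment> \<open>The integer with \<open>(s - a) / (m + 1) \<le> u \<le> (s - a) / m\<close>. It
    is positive because \<open>u \<le> s - a\<close>, and the slice index is
    \<open>m - 1\<close>.\<close>
  define m where "m = nat \<lfloor>(s - a) / u\<rfloor>"
  have u: "0 < u" "u \<le> s - a" using x le_s by (auto simp: u_def)
  have "1 \<le> (s - a) / u" using u by simp
  then have m: "1 \<le> m" "real m \<le> (s - a) / u" "(s - a) / u < real m + 1"
    unfolding m_def by linarith+
  have up: "u \<le> (s - a) / real m" and lo: "(s - a) / (real m + 1) \<le> u"
    using m u by (auto simp: field_simps)
  obtain k where k: "m = Suc k" using m(1) by (cases m) auto
  have "x \<in> slice C f a k"
    using up lo x(1) by (simp add: slice_def u_def k algebra_simps)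
  then show ?thesis ..
qed

text \<open>The lower level of slice \<open>k\<close> must not exceed the upper level of slice
  \<open>k'\<close>; as levels decrease strictly with the index, this leaves only the common face of
  neighbours.\<close>

lemma slice_inter:
  assumes "x \<in> slice C f a k" "x \<in> slice C f a k'" "k < k'"
  shows "k' = Suc k \<and> f x = a + (s - a) / (real k + 2)"
proof -
  have lo: "a + (s - a) / (real k + 2) \<le> f x" and up: "f x \<le> a + (s - a) / (real k' + 1)"
    using assms by (auto simp: slice_def)
  then have "(s - a) / (real k + 2) \<le> (s - a) / (real k' + 1)" by linarith
  moreover have "(s - a) / (real k' + 1) < (s - a) / (real k + 2)" if "real k + 2 < real k' + 1"
    using a_less_s that by (intro divide_strict_left_mono) auto
  ultimately have "real k' + 1 \<le> real k + 2" by linarith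
  with assms(3) have k': "k' = Suc k" by simp
  have "real k' + 1 = real k + 2" by (simp add: k')
  with up have "f x \<le> a + (s - a) / (real k + 2)" by (simp only:)
  with lo k' show ?thesis by simp
qed

lemma closed_slice: "closed (slice C f a k)"
proof -
  have cont: "continuous_on UNIV f"
    by (rule linear_continuous_on[OF blin])
  have "slice C f a k = C \<inter> {x. a + (s - a) / (real k + 2) \<le> f x} \<inter>
      {x. f x \<le> a + (s - a) / (real k + 1)}"
    by (auto simp: slice_def)
  then show ?thesis
    using closed cont by (simp add: closed_Int closed_Collect_le)
qed

lemma convex_slice: "convex (slice C f a k)"
proof -
  have "slice C f a k = C \<inter> f -` {a + (s - a) / (real k + 2)..a + (s - a) / (real k + 1)}"
    by (auto simp: slice_def)
  then show ?thesis
    using convex_linear_vimage[OF bounded_linear.linear[OF blin]] convex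
    by (simp add: convex_Int)
qed

text \<open>Contracting a point of \<open>C\<close> above the lower level towards the centre
  \<open>0\<close> brings its \<open>f\<close>-value strictly inside the slice and carries the ball
  around \<open>0\<close> to a ball around the new point within \<open>C\<close>.\<close>

lemma interior_slice_nonempty: "interior (slice C f a k) \<noteq> {}"
proof -
  define l where "l = a + (s - a) / (real k + 2)"
  define h where "h = a + (s - a) / (real k + 1)"
  have lh: "l < h"
    using a_less_s by (simp add: l_def h_def frac_less2)
  have "(s - a) / (real k + 2) < s - a"
    using a_less_s mult_strict_left_mono[of 1 "real k + 2" "s - a"] by (simp add: pos_divide_less_eq)
  then have "l < s" by (simp add: l_def)
  moreover have "C \<noteq> {}" using exceeds by blast
  ultimately obtain x where x: "x \<in> C" "l < f x"
    using less_cSup_iff[of "f ` C" l] bdd by auto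
  \<comment> \<open>Below \<open>h\<close> to land inside the slice, and below \<open>f x\<close> to
    make the contraction factor \<open>c / f x\<close> less than 1.\<close>
  obtain c where c: "l < c" "c < min h (f x)"
    using dense[of l "min h (f x)"] lh x(2) by auto
  have "0 < l" using a_pos a_less_s by (simp add: l_def add_pos_pos)
  then have fx: "0 < c" "c < f x" using c by auto
  define z where "z = (c / f x) *\<^sub>R x"
  have fz: "f z = c"
    using fx linear_scale[OF bounded_linear.linear[OF blin]] by (simp add: z_def)
  have "ball (x + (1 - c / f x) *\<^sub>R (0 - x)) ((1 - c / f x) * e) \<subseteq> C"
    using fx by (intro ball_shrink_subset_convex[OF convex ball x(1)]) (auto simp: field_simps)
  moreover have "x + (1 - c / f x) *\<^sub>R (0 - x) = z"
    by (simp add: z_def algebra_simps)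
  moreover have "0 < (1 - c / f x) * e"
    using fx e_pos by simp
  ultimately have zC: "z \<in> interior C"
    by (auto simp: mem_interior)
  have cont: "continuous_on UNIV f"
    by (rule linear_continuous_on[OF blin])
  have "open (interior C \<inter> {x. l < f x} \<inter> {x. f x < h})"
    using cont by (intro open_Int open_Collect_less open_interior) auto
  moreover have "interior C \<inter> {x. l < f x} \<inter> {x. f x < h} \<subseteq> slice C f a k"
    using interior_subset[of C] by (auto simp: slice_def l_def h_def)
  moreover have "z \<in> interior C \<inter> {x. l < f x} \<inter> {x. f x < h}"
    using zC fz c by auto
  ultimately show ?thesis
    using interior_maximal by blast
qed

text \<open>A ball inside the level set would contain a short step along a vector \<open>v\<close>
  with \<open>f v > 0\<close>, and this step changes \<open>f\<close>.\<close>

lemma interior_level_set: "interior {x. f x = c} = {}"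
proof (rule ccontr)
  obtain v where v: "0 < f v" using exceeds a_pos less_trans by blast
  assume "interior {x. f x = c} \<noteq> {}"
  then obtain z d where d: "0 < d" and b: "ball z d \<subseteq> {x. f x = c}"
    by (auto simp: mem_interior)
  have "v \<noteq> 0" using v linear_0[OF bounded_linear.linear[OF blin]] by auto
  then have "z + (d / 2 / norm v) *\<^sub>R v \<in> ball z d" using d by (simp add: dist_norm)
  moreover have "z \<in> ball z d" using d by simp
  ultimately have "f (z + (d / 2 / norm v) *\<^sub>R v) = f z" using b by blast
  then show False
    using v d \<open>v \<noteq> 0\<close> linear_add[OF bounded_linear.linear[OF blin]]
      linear_scale[OF bounded_linear.linear[OF blin]] by simp
qed

lemma interior_slices_disjoint:
  assumes "k \<noteq> k'"
  shows "interior (slice C f a k) \<inter> interior (slice C f a k') = {}"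
proof -
  have *: "interior (slice C f a i) \<inter> interior (slice C f a j) = {}" if "i < j" for i j
  proof -
    have "slice C f a i \<inter> slice C f a j \<subseteq> {x. f x = a + (s - a) / (real i + 2)}"
      using slice_inter that by blast
    then show ?thesis
      using interior_mono interior_level_set by (metis interior_Int subset_empty)
  qed
  show ?thesis
    using *[of k k'] *[of k' k] assms by (cases k k' rule: linorder_cases) auto
qed

lemma slices_containing: "\<exists>A B. \<forall>k. x \<in> slice C f a k \<longrightarrow> slice C f a k \<in> {A, B}"
proof (cases "\<exists>k. x \<in> slice C f a k")
  case True
  define k0 where "k0 = (LEAST k. x \<in> slice C f a k)"
  have k0: "x \<in> slice C f a k0" using True unfolding k0_def by (rule LeastI_ex)
  \<comment> \<open>Every other slice through \<open>x\<close> has a larger index than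
    \<open>k0\<close>, hence is its immediate successor.\<close>
  have "k = k0 \<or> k = Suc k0" if "x \<in> slice C f a k" for k
    using slice_inter[OF k0 that] Least_le[of "\<lambda>k. x \<in> slice C f a k", OF that]
    unfolding k0_def[symmetric] by linarith
  then show ?thesis by blast
qed auto

end

section \<open>Cutting the shells\<close>

text \<open>What is left of the ball of radius \<open>n + 1\<close> after all functionals strictly
  before \<open>f\<close> have cut off their open half-spaces \<open>g > n\<close>. The hyperplanes
  stay, so the remainder is closed.\<close>

definition remainder :: "(('a::real_normed_vector \<Rightarrow> real) rel) \<Rightarrow> nat \<Rightarrow> ('a \<Rightarrow> real) \<Rightarrow> 'a set" where
  "remainder r n f = cball 0 (real n + 1) \<inter>
     {x. \<forall>g\<in>dual_ball. (g, f) \<in> r - Id \<longrightarrow> g x \<le> real n}"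

text \<open>Selects the functionals that still cut off something, so that the supremum in
  \<open>slice\<close> exceeds \<open>n\<close>.\<close>

definition cutting :: "(('a::real_normed_vector \<Rightarrow> real) rel) \<Rightarrow> nat \<Rightarrow> ('a \<Rightarrow> real) \<Rightarrow> bool" where
  "cutting r n f \<longleftrightarrow> 1 \<le> n \<and> f \<in> dual_ball \<and> (\<exists>x\<in>remainder r n f. real n < f x)"

abbreviation cut_tile :: "(('a::real_normed_vector \<Rightarrow> real) rel) \<Rightarrow> nat \<Rightarrow> ('a \<Rightarrow> real) \<Rightarrow> nat \<Rightarrow> 'a set"
  where "cut_tile r n f k \<equiv> slice (remainder r n f) f (real n) k"

lemma sliced_body_remainder:
  assumes "cutting r n f"
  shows "sliced_body (remainder r n f) f (real n) 1 (real n + 1)"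
proof
  have half: "{x. g x \<le> real n} = g -` {..real n}" for g :: "'a \<Rightarrow> real" by auto
  have eq: "remainder r n f = cball 0 (real n + 1) \<inter>
      (\<Inter>g\<in>{g \<in> dual_ball. (g, f) \<in> r - Id}. {x. g x \<le> real n})"
    by (auto simp: remainder_def)
  show "convex (remainder r n f)"
    unfolding eq half
    by (intro convex_Int convex_INT convex_cball convex_linear_vimage)
      (auto simp: dual_ball_def)
  show "closed (remainder r n f)"
    unfolding eq
    by (intro closed_Int closed_INT closed_cball ballI closed_Collect_le continuous_on_const)
      (auto intro!: linear_continuous_on dual_ball_bounded_linear)
  show "remainder r n f \<subseteq> cball 0 (real n + 1)"
    by (auto simp: remainder_def)
  \<comment> \<open>A point of norm below \<open>1 \<le> n\<close> satisfies \<open>g x < n\<close>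
    for each \<open>g\<close> in the dual ball, so no cut reaches it.\<close>
  show "ball 0 1 \<subseteq> remainder r n f"
  proof
    fix x :: 'a assume "x \<in> ball 0 1"
    then have x: "norm x < real n" using assms by (simp add: cutting_def)
    then have "g x \<le> real n" if "g \<in> dual_ball" for g
      using that by (force simp: dual_ball_def intro: order_trans[of _ "norm x"])
    then show "x \<in> remainder r n f" using x by (auto simp: remainder_def)
  qed
qed (use assms in \<open>auto simp: cutting_def\<close>)

text \<open>The chain \<open>n < f x \<le> norm x \<le> n + 1\<close> determines the shell. If one
  functional came strictly before the other, membership in the later remainder would contradict
  \<open>f x > n\<close> for the earlier one.\<close>

lemma cut_tile_unique:
  assumes r: "Well_order r" "Field r = UNIV"
    and nf: "cutting r n f" "x \<in> cut_tile r n f k"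
    and nf': "cutting r n' f'" "x \<in> cut_tile r n' f' k'"
  shows "n = n' \<and> f = f'"
proof -
  note sb = sliced_body_remainder[OF nf(1)] and sb' = sliced_body_remainder[OF nf'(1)]
  have fD: "f \<in> dual_ball" "f' \<in> dual_ball" using nf(1) nf'(1) by (auto simp: cutting_def)
  have x: "x \<in> remainder r n f" "real n < f x" "x \<in> remainder r n' f'" "real n' < f' x"
    using sliced_body.slice_subset[OF sb] sliced_body.slice_exceeds[OF sb nf(2)]
      sliced_body.slice_subset[OF sb'] sliced_body.slice_exceeds[OF sb' nf'(2)] nf(2) nf'(2) by auto
  have "f x \<le> norm x" "f' x \<le> norm x" using fD by (auto simp: dual_ball_def)
  moreover have "norm x \<le> real n + 1" "norm x \<le> real n' + 1"
    using x by (auto simp: remainder_def)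
  ultimately have n: "n = n'" using x by linarith
  have "(f, f') \<notin> r - Id" "(f', f) \<notin> r - Id"
    using x fD n by (auto simp: remainder_def)
  moreover have "total_on UNIV r"
    using r by (auto simp: well_order_on_def linear_order_on_def)
  ultimately show ?thesis using n by (auto simp: total_on_def)
qed

text \<open>The tile comes from the first functional in the well-order whose value at
  \<open>x\<close> exceeds \<open>n\<close>: no earlier one has removed \<open>x\<close>.\<close>

lemma cut_tiles_cover:
  assumes r: "Well_order r" "Field r = UNIV" and x: "1 < norm x"
  shows "\<exists>n f k. cutting r n f \<and> x \<in> cut_tile r n f k"
proof -
  \<comment> \<open>Ceiling minus one puts a point of integer norm into the inner of the two
    adjacent shells, so that \<open>n < norm x\<close> is strict.\<close>
  define n where "n = nat (\<lceil>norm x\<rceil> - 1)"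
  have n: "1 \<le> n" "real n < norm x" "norm x \<le> real n + 1"
    unfolding n_def using x by linarith+
  define Q where "Q = {f \<in> dual_ball. real n < f x}"
  \<comment> \<open>A norming functional of \<open>x\<close> has the value
    \<open>norm x > n\<close>.\<close>
  obtain f0 where "f0 \<in> Q"
    using Hahn_Banach_norm[of x] n(2) unfolding Q_def by (metis (mono_tags, lifting) mem_Collect_eq)
  moreover have "wf (r - Id)" using r(1) by (simp add: well_order_on_def)
  ultimately obtain f where f: "f \<in> Q" "\<And>g. (g, f) \<in> r - Id \<Longrightarrow> g \<notin> Q"
    using wfE_min by metis
  have xC: "x \<in> remainder r n f"
    using f n(3) by (force simp: remainder_def Q_def)
  then have cut: "cutting r n f"
    using f n(1) by (auto simp: cutting_def Q_def)
  have "\<exists>k. x \<in> cut_tile r n f k"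
    using sliced_body.slices_cover[OF sliced_body_remainder[OF cut] xC] f by (simp add: Q_def)
  with cut show ?thesis by blast
qed

text \<open>Separates the cut tiles from the closed unit ball, including its boundary.\<close>

lemma cut_tile_norm:
  assumes "cutting r n f" "x \<in> cut_tile r n f k"
  shows "1 < norm x"
proof -
  have "real n < f x"
    using sliced_body.slice_exceeds[OF sliced_body_remainder[OF assms(1)] assms(2)] .
  moreover have "f x \<le> norm x" "1 \<le> real n" using assms(1) by (auto simp: cutting_def dual_ball_def)
  ultimately show ?thesis by linarith
qed

section \<open>The order bound and the assembled tiling\<close>

lemma covering_order_le_2:
  assumes "\<And>x. \<exists>A B. {T \<in> \<tau>. x \<in> T} \<subseteq> {A, B}"
  shows "covering_order \<tau> \<le> 2"
  unfolding covering_order_def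
proof (rule Sup_least)
  fix m assume "m \<in> {enat n |n. \<exists>S\<subseteq>\<tau>. finite S \<and> card S = n \<and> \<Inter> S \<noteq> {}}"
  then obtain S x where S: "S \<subseteq> \<tau>" and m: "m = enat (card S)" and x: "x \<in> \<Inter> S"
    by blast
  obtain A B where "{T \<in> \<tau>. x \<in> T} \<subseteq> {A, B}" using assms by blast
  then have "S \<subseteq> {A, B}" using S x by blast
  then have "card S \<le> card {A, B}" by (intro card_mono) auto
  also have "\<dots> \<le> 2" by (simp add: card_insert_if)
  finally show "m \<le> 2" unfolding m by (metis enat_ord_simps(1) numeral_eq_enat)
qed

theorem mainTheorem1:
  fixes X_witness :: "'a::banach"
  assumes "X_witness \<noteq> 0"
  shows "\<exists>\<tau> :: 'a set set. is_tiling \<tau> \<and> covering_order \<tau> \<le> 2 \<and>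
           (\<forall>T\<in>\<tau>. closed T \<and> convex T \<and> bounded T)"
proof -
  \<comment> \<open>A single well-order of the functionals serves all shells.\<close>
  obtain r :: "('a \<Rightarrow> real) rel" where r: "Well_order r" "Field r = UNIV"
    using well_ordering[where 'a = "'a \<Rightarrow> real"] by blast
  define \<tau> where "\<tau> = insert (cball (0::'a) 1) {cut_tile r n f k | n f k. cutting r n f}"
  have tile_cases: "T = cball 0 1 \<or> (\<exists>n f k. cutting r n f \<and> T = cut_tile r n f k)"
    if "T \<in> \<tau>" for T
    using that by (auto simp: \<tau>_def)
  have ball_or_cut: "cball 0 1 \<inter> cut_tile r n f k = {}" if "cutting r n f" for n f k
    using cut_tile_norm[OF that] by fastforce
  have good: "closed T \<and> convex T \<and> bounded T \<and> interior T \<noteq> {}" if "T \<in> \<tau>" for T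
    using tile_cases[OF that]
  proof (elim disjE exE conjE)
    assume "T = cball 0 1"
    moreover have "(0::'a) \<in> interior (cball 0 1)"
      by (auto simp: mem_interior intro!: exI[of _ 1])
    ultimately show ?thesis by auto
  next
    fix n f k assume cut: "cutting r n f" and T: "T = cut_tile r n f k"
    interpret sliced_body "remainder r n f" f "real n" 1 "real n + 1"
      by (rule sliced_body_remainder[OF cut])
    show ?thesis
      using closed_slice convex_slice interior_slice_nonempty
        bounded_subset[OF bounded_cball order_trans[OF slice_subset bounded]] by (auto simp: T)
  qed
  have not_UNIV: "T \<noteq> UNIV" if "T \<in> \<tau>" for T
    using good[OF that] bounded_ne_UNIV[OF _ assms] by blast
  have "x \<in> \<Union>\<tau>" for x
    using cut_tiles_cover[OF r, of x] by (cases "norm x \<le> 1") (auto simp: \<tau>_def)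
  then have cover: "\<Union>\<tau> = UNIV" by blast
  have disjoint: "interior A \<inter> interior B = {}" if AB: "A \<in> \<tau>" "B \<in> \<tau>" "A \<noteq> B" for A B
  proof (rule ccontr)
    assume "interior A \<inter> interior B \<noteq> {}"
    then obtain x where x: "x \<in> interior A" "x \<in> interior B" by blast
    then have xAB: "x \<in> A" "x \<in> B" using interior_subset by blast+
    \<comment> \<open>If one of the two were the unit ball, the other would be a cut tile and could
      not contain \<open>x\<close>.\<close>
    have "A \<noteq> cball 0 1" "B \<noteq> cball 0 1"
      using tile_cases[OF AB(1)] tile_cases[OF AB(2)] AB(3) xAB ball_or_cut by blast+
    then obtain n f k n' f' k' where A: "cutting r n f" "A = cut_tile r n f k"
      and B: "cutting r n' f'" "B = cut_tile r n' f' k'"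
      using tile_cases[OF AB(1)] tile_cases[OF AB(2)] by blast
    have same: "n = n'" "f = f'"
      using cut_tile_unique[OF r A(1) _ B(1)] xAB A(2) B(2) by blast+
    then have "k \<noteq> k'" using AB(3) A(2) B(2) by blast
    then show False
      using sliced_body.interior_slices_disjoint[OF sliced_body_remainder[OF A(1)]] x A(2) B(2) same
      by blast
  qed
  have "\<exists>A B. {T \<in> \<tau>. x \<in> T} \<subseteq> {A, B}" for x
  proof (cases "\<exists>n f k. cutting r n f \<and> x \<in> cut_tile r n f k")
    case True
    then obtain n f k where nfk: "cutting r n f" "x \<in> cut_tile r n f k" by blast
    \<comment> \<open>By uniqueness of \<open>n\<close> and \<open>f\<close>, bounding the slices of
      this one remainder bounds all tiles through \<open>x\<close>.\<close>
    obtain A B where AB: "\<And>j. x \<in> cut_tile r n f j \<Longrightarrow> cut_tile r n f j \<in> {A, B}"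
      using sliced_body.slices_containing[OF sliced_body_remainder[OF nfk(1)]] by meson
    have "T \<in> {A, B}" if T_in: "T \<in> \<tau>" "x \<in> T" for T
    proof -
      have "T \<noteq> cball 0 1" using nfk T_in(2) ball_or_cut by blast
      then obtain n' f' k' where T: "cutting r n' f'" "T = cut_tile r n' f' k'"
        using tile_cases[OF T_in(1)] by blast
      then have "n = n' \<and> f = f'"
        using cut_tile_unique[OF r nfk T(1)] T_in(2) by blast
      then show ?thesis using AB[of k'] T(2) T_in(2) by blast
    qed
    then show ?thesis by blast
  next
    case False
    \<comment> \<open>Only the unit ball can contain such a point, so the pair is
      degenerate.\<close>
    then have "{T \<in> \<tau>. x \<in> T} \<subseteq> {cball 0 1, cball 0 1}"
      using tile_cases by blast
    then show ?thesis by blast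
  qed
  then have "covering_order \<tau> \<le> 2" by (rule covering_order_le_2)
  moreover have "is_tiling \<tau>"
    unfolding is_tiling_def is_covering_def
    using good not_UNIV cover disjoint is_body_convex by blast
  ultimately show ?thesis using good by blast
qed

end
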